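(* Let $\epsilon>0$ and consider any instance of problem (P) (defined in the context) with $K$ users. Then the branch-and-bound algorithm (B&B) described in the context, run with error tolerance $\epsilon$, terminates and returns an $\epsilon$-optimal solution of problem (P) within $$\left(\frac{\Gamma_{\max}}{\delta}\right)^{K}+1$$ iterations, where $$\Gamma_{\max}=\max_{k\in\{1,\ldots,K\}}\frac{P_T\|\mathbf h_k\|^2}{\sigma_C^2},\qquad \delta=\frac12\left(\exp\left(\frac{\epsilon}{K}\right)-1\right).$$
   Context: Notation and data. $[K]=\{1,\ldots,K\}$; $\log$ is the natural logarithm; $\succeq$ is the positive semidefinite (Loewner) order on Hermitian matrices; $\mathrm{Tr}$ is the trace; $\|\cdot\|$ is the Euclidean norm. An instance consists of positive integers $K\le N_t$, vectors $\mathbf h_k\in\mathbb C^{N_t\times 1}$ ($k\in[K]$), a noise variance $\sigma_C^2>0$, a power budget $P_T>0$ and a trade-off weight $\rho>0$. Put $\mathbf Q_k=\mathbf h_k\mathbf h_k^H$. Problem (P). Over real numbers $\Gamma_1,\ldots,\Gamma_K$ (with $\Gamma_k>-1$, so that the objective is defined), Hermitian matrices $\mathbf W_1,\ldots,\mathbf W_K\in\mathbb C^{N_t\times N_t}$ and an invertible Hermitian matrix $\mathbf R_X\in\mathbb C^{N_t\times N_t}$, minimize $$\Phi\left(\mathbf R_X,\{\Gamma_k\}_{k=1}^K,\{\mathbf W_k\}_{k=1}^K\right)=-\sum_{k=1}^K\log(1+\Gamma_k)+\rho\,\mathrm{Tr}(\mathbf R_X^{-1})$$ subject to $\mathrm{Tr}(\mathbf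 R_X)\le P_T$, $\mathbf R_X\succeq\sum_{k=1}^K\mathbf W_k$, and, for all $k\in[K]$, $\mathbf W_k\succeq 0$ and $$\mathrm{Tr}(\mathbf Q_k\mathbf W_k)-\Gamma_k\,\mathrm{Tr}(\mathbf Q_k(\mathbf R_X-\mathbf W_k))\ge\Gamma_k\sigma_C^2 .$$ Let $\nu^*$ be the optimal value of (P). A feasible point of (P) is called an $\epsilon$-optimal solution if its objective value satisfies $\Phi-\nu^*\le\epsilon$. Relaxation MER$(\mathcal Q)$. Let $b_k=P_T\|\mathbf h_k\|^2$. For a box $\mathcal Q=\prod_{k=1}^K[\ell_k,u_k]$, MER$(\mathcal Q)$ is the convex problem of minimizing $-\sum_{k}\log(1+\Gamma_k)+\rho\,\mathrm{Tr}(\mathbf R_X^{-1})$ over an invertible Hermitian matrix $\mathbf R_X\in\mathbb C^{N_t\times N_t}$, real numbers $\{\Gamma_k\}_{k=1}^K$ with $\Gamma_k>-1$, Hermitian matrices $\{\mathbf W_k\}_{k=1}^K$ in $\mathbb C^{N_t\times N_t}$ and real numbers $\{s_k\}$ subject to $\mathrm{Tr}(\mathbf R_X)\le P_T$, $\mathbf R_X\succeq\sum_k\mathbf W_k$, and, for all $k\in[K]$, writing $I_k=\mathrm{Tr}(\mathbf Q_k(\mathbf R_X-\mathbf W_k))$: $\mathbf W_k\succeq0$, $\mathrm{Tr}(\mathbf Q_k\mathbf W_k)-s_k\ge\Gamma_k\sigma_C^2$, $\ell_k\le\Gamma_k\le u_k$, $0\le I_k\le b_k$, and $$s_k\ge\ell_kI_k,\quad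 s_k\ge u_kI_k+(\Gamma_k-u_k)b_k,\quad s_k\le u_kI_k,\quad s_k\le(\Gamma_k-\ell_k)b_k+\ell_kI_k .$$ Each MER problem is assumed to be solved exactly; its optimal value is denoted $L$ (with $L=+\infty$ if it is infeasible), and its optimal solution is denoted $\mathbf V$. Constructed feasible point. Given an optimal solution $\mathbf V$ of MER$(\mathcal Q)$ with components $\mathbf R_X,\{\Gamma_k\},\{\mathbf W_k\},\{s_k\}$, set $\hat{\mathbf R}_X=\mathbf R_X$, $\hat{\mathbf W}_k=\mathbf W_k$ and $$\hat\Gamma_k=\frac{\Gamma_k\sigma_C^2+\ell_kI_k}{\sigma_C^2+I_k},\quad k\in[K];$$ this point is feasible for (P), and $\hat U=-\sum_k\log(1+\hat\Gamma_k)+\rho\,\mathrm{Tr}(\hat{\mathbf R}_X^{-1})$ denotes its objective value. Algorithm (B&B) with error tolerance $\epsilon$. Initialization: let $\mathcal Q^0=\prod_{k=1}^K\left[0,P_T\|\mathbf h_k\|^2/\sigma_C^2\right]$; solve MER$(\mathcal Q^0)$ to get $(\mathcal Q^0,\mathbf V^0,L^0)$, put it in the problem list $\mathcal P$, compute the constructed feasible point and set the upper bound $U$ to be its value $\hat U$ and the incumbent to be this point. Iterations $t=1,2,\ldots$: (1) Let $(\mathcal Q^t,\mathbf V^t,L^t)$ be an element of $\mathcal P$ with smallest lower bound $L^t$, and let $U^t$ be the current upper bound (the best objective value among all feasible points constructed so far). If $U^t-L^t<\epsilon$, terminate and return $U^t$ and the incumbent (the best constructed feasible point so far). (2) Otherwise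 delete this element from $\mathcal P$. With $\Gamma_k^t$ the component of $\mathbf V^t$ and $\hat\Gamma_k^t$ the corresponding constructed value, choose $$k^*\in\arg\max_{k\in[K]}\frac{\Gamma_k^t-\hat\Gamma_k^t}{1+\hat\Gamma_k^t},$$ and split $\mathcal Q^t$ into two boxes $\mathcal Q_1^t,\mathcal Q_2^t$ by bisecting its $k^*$-th interval $[\ell_{k^*}^t,u_{k^*}^t]$ at the midpoint $\tfrac12(\ell_{k^*}^t+u_{k^*}^t)$, leaving the other intervals unchanged. (3) For $j=1,2$: solve MER$(\mathcal Q_j^t)$ to get $\mathbf V_j^t,L_j^t$; compute the constructed feasible point and its value $\hat U$ (if MER$(\mathcal Q_j^t)$ is feasible); if $L_j^t\le$ the current upper bound, add $(\mathcal Q_j^t,\mathbf V_j^t,L_j^t)$ to $\mathcal P$; if $\hat U\le$ the current upper bound, replace the upper bound by $\hat U$ and the incumbent by this constructed point. The number of iterations is the number of values of $t$ executed, including the one in which the algorithm terminates. *)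

theory Defs
  imports "HOL-Analysis.Analysis" "HOL-Library.Multiset" "HOL-Library.Extended_Real"
begin

definition hermitian_mat :: "complex^'n^'n \<Rightarrow> bool" where
  "hermitian_mat A \<longleftrightarrow> (\<forall>i j. A $ i $ j = cnj (A $ j $ i))"

text \<open>For a Hermitian matrix the quadratic form is real, so taking \<open>Re\<close> loses nothing.\<close>

definition psd_mat :: "complex^'n^'n \<Rightarrow> bool" where
  "psd_mat A \<longleftrightarrow> hermitian_mat A \<and> (\<forall>x. 0 \<le> Re (\<Sum>i\<in>UNIV. cnj (x $ i) * (A *v x) $ i))"

definition loewner_le :: "complex^'n^'n \<Rightarrow> complex^'n^'n \<Rightarrow> bool" where
  "loewner_le A B \<longleftrightarrow> psd_mat (B - A)"

text \<open>\<open>outer_mat h\<close> is \<open>h h\<^sup>H\<close>.\<close>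

definition outer_mat :: "complex^'n \<Rightarrow> complex^'n^'n" where
  "outer_mat h = (\<chi> i j. h $ i * cnj (h $ j))"

text \<open>All traces below are traces of Hermitian matrices or of products of two Hermitian
  matrices, hence real.\<close>

definition rtrace :: "complex^'n^'n \<Rightarrow> real" where
  "rtrace A = Re (trace A)"

text \<open>The users are the elements of the finite type \<open>'k\<close> and the antennas those of \<open>'n\<close>, so
  that \<open>K = CARD('k)\<close> and \<open>N\<^sub>t = CARD('n)\<close>.\<close>

record ('n::finite, 'k::finite) inst =
  channel :: "'k \<Rightarrow> complex^'n"
  noise :: real
  budget :: real
  weight :: real

record ('n::finite, 'k::finite) point =
  covX :: "complex^'n^'n"
  sinr :: "'k \<Rightarrow> real"
  beam :: "'k \<Rightarrow> complex^'n^'n"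

definition Qmat :: "('n::finite, 'k::finite) inst \<Rightarrow> 'k \<Rightarrow> complex^'n^'n" where
  "Qmat I k = outer_mat (channel I k)"

definition interference ::
  "('n::finite, 'k::finite) inst \<Rightarrow> ('n, 'k, 'z) point_scheme \<Rightarrow> 'k \<Rightarrow> real" where
  "interference I p k = rtrace (Qmat I k ** (covX p - beam p k))"

definition objective ::
  "('n::finite, 'k::finite) inst \<Rightarrow> ('n, 'k, 'z) point_scheme \<Rightarrow> real" where
  "objective I p =
     - (\<Sum>k\<in>UNIV. ln (1 + sinr p k)) + weight I * rtrace (matrix_inv (covX p))"

definition common_constraints ::
  "('n::finite, 'k::finite) inst \<Rightarrow> ('n, 'k, 'z) point_scheme \<Rightarrow> bool" where
  "common_constraints I p \<longleftrightarrow>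
     hermitian_mat (covX p) \<and> invertible (covX p) \<and>
     rtrace (covX p) \<le> budget I \<and>
     loewner_le (\<Sum>k\<in>UNIV. beam p k) (covX p) \<and>
     (\<forall>k. sinr p k > -1 \<and> hermitian_mat (beam p k) \<and> loewner_le 0 (beam p k))"

definition P_feasible ::
  "('n::finite, 'k::finite) inst \<Rightarrow> ('n, 'k) point \<Rightarrow> bool" where
  "P_feasible I p \<longleftrightarrow>
     common_constraints I p \<and>
     (\<forall>k. rtrace (Qmat I k ** beam p k) - sinr p k * interference I p k
            \<ge> sinr p k * noise I)"

text \<open>Here \<open>noise I\<close> is the variance \<open>\<sigma>\<^sub>C\<^sup>2\<close> itself. The optimal value is taken in the extended reals,
  where an infimum is meaningful without any boundedness or attainment proviso.\<close>

definition P_value :: "('n::finite, 'k::finite) inst \<Rightarrow> ereal" where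
  "P_value I = (INF p\<in>{p. P_feasible I p}. ereal (objective I p))"

definition eps_optimal ::
  "('n::finite, 'k::finite) inst \<Rightarrow> real \<Rightarrow> ('n, 'k) point \<Rightarrow> bool" where
  "eps_optimal I \<epsilon> p \<longleftrightarrow> P_feasible I p \<and> ereal (objective I p) - P_value I \<le> ereal \<epsilon>"

text \<open>The box \<open>Q\<close> has the interval \<open>[fst (Q k), snd (Q k)]\<close> as its \<open>k\<close>-th factor.\<close>

type_synonym 'k box = "'k \<Rightarrow> real \<times> real"

record ('n::finite, 'k::finite) mer_point = "('n, 'k) point" +
  slack :: "'k \<Rightarrow> real"

definition int_bound :: "('n::finite, 'k::finite) inst \<Rightarrow> 'k \<Rightarrow> real" where
  "int_bound I k = budget I * (norm (channel I k))\<^sup>2"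

definition mer_feasible ::
  "('n::finite, 'k::finite) inst \<Rightarrow> 'k box \<Rightarrow> ('n, 'k) mer_point \<Rightarrow> bool" where
  "mer_feasible I Q V \<longleftrightarrow>
     common_constraints I V \<and>
     (\<forall>k. let l = fst (Q k); u = snd (Q k); b = int_bound I k;
              g = sinr V k; s = slack V k; i = interference I V k
          in rtrace (Qmat I k ** beam V k) - s \<ge> g * noise I \<and>
             l \<le> g \<and> g \<le> u \<and> 0 \<le> i \<and> i \<le> b \<and>
             s \<ge> l * i \<and> s \<ge> u * i + (g - u) * b \<and>
             s \<le> u * i \<and> s \<le> (g - l) * b + l * i)"

definition mer_optimal ::
  "('n::finite, 'k::finite) inst \<Rightarrow> 'k box \<Rightarrow> ('n, 'k) mer_point \<Rightarrow> bool" where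
  "mer_optimal I Q V \<longleftrightarrow>
     mer_feasible I Q V \<and> (\<forall>V'. mer_feasible I Q V' \<longrightarrow> objective I V \<le> objective I V')"

text \<open>This is \<open>\<infinity>\<close> if the relaxation is infeasible.\<close>

definition mer_value :: "('n::finite, 'k::finite) inst \<Rightarrow> 'k box \<Rightarrow> ereal" where
  "mer_value I Q = (INF V\<in>{V. mer_feasible I Q V}. ereal (objective I V))"

definition hat_sinr ::
  "('n::finite, 'k::finite) inst \<Rightarrow> 'k box \<Rightarrow> ('n, 'k) mer_point \<Rightarrow> 'k \<Rightarrow> real" where
  "hat_sinr I Q V k =
     (sinr V k * noise I + fst (Q k) * interference I V k) / (noise I + interference I V k)"

definition hat_point ::
  "('n::finite, 'k::finite) inst \<Rightarrow> 'k box \<Rightarrow> ('n, 'k) mer_point \<Rightarrow> ('n, 'k) point" where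
  "hat_point I Q V = \<lparr>covX = covX V, sinr = hat_sinr I Q V, beam = beam V\<rparr>"

text \<open>A node \<open>(Q, V, L)\<close> consists of a box, an optimal solution of its relaxation and the
  optimal value. A state is what the algorithm holds at the beginning of an iteration. The
  algorithm leaves open which optimal solution a relaxation yields, how ties are broken and which
  half is processed first; it is therefore a relation between states, covering all these choices.\<close>

type_synonym ('n, 'k) node = "'k box \<times> ('n, 'k) mer_point \<times> ereal"

record ('n::finite, 'k::finite) bnb_state =
  problems :: "('n, 'k) node multiset"
  upper :: real
  incumbent :: "('n, 'k) point"

definition init_box :: "('n::finite, 'k::finite) inst \<Rightarrow> 'k box" where
  "init_box I = (\<lambda>k. (0, budget I * (norm (channel I k))\<^sup>2 / noise I))"

definition bnb_init ::
  "('n::finite, 'k::finite) inst \<Rightarrow> ('n, 'k) bnb_state \<Rightarrow> bool" where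
  "bnb_init I s \<longleftrightarrow>
     (\<exists>V. mer_optimal I (init_box I) V \<and>
          s = \<lparr>problems = {#(init_box I, V, mer_value I (init_box I))#},
               upper = objective I (hat_point I (init_box I) V),
               incumbent = hat_point I (init_box I) V\<rparr>)"

definition least_node ::
  "('n::finite, 'k::finite) bnb_state \<Rightarrow> ('n, 'k) node \<Rightarrow> bool" where
  "least_node s nd \<longleftrightarrow>
     nd \<in># problems s \<and> (\<forall>nd'\<in>#problems s. snd (snd nd) \<le> snd (snd nd'))"

definition bnb_stops :: "real \<Rightarrow> ('n::finite, 'k::finite) bnb_state \<Rightarrow> bool" where
  "bnb_stops \<epsilon> s \<longleftrightarrow>
     (\<exists>Q V L. least_node s (Q, V, L) \<and> ereal (upper s) - L < ereal \<epsilon>)"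

definition gap ::
  "('n::finite, 'k::finite) inst \<Rightarrow> 'k box \<Rightarrow> ('n, 'k) mer_point \<Rightarrow> 'k \<Rightarrow> real" where
  "gap I Q V k = (sinr V k - hat_sinr I Q V k) / (1 + hat_sinr I Q V k)"

definition midpt :: "'k box \<Rightarrow> 'k \<Rightarrow> real" where
  "midpt Q k = (fst (Q k) + snd (Q k)) / 2"

definition lower_half :: "'k box \<Rightarrow> 'k \<Rightarrow> 'k box" where
  "lower_half Q k = Q(k := (fst (Q k), midpt Q k))"

definition upper_half :: "'k box \<Rightarrow> 'k \<Rightarrow> 'k box" where
  "upper_half Q k = Q(k := (midpt Q k, snd (Q k)))"

text \<open>For an infeasible box the lower bound is
  \<open>\<infinity>\<close>, which exceeds the upper bound, and no point is constructed.\<close>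

inductive process_box ::
  "('n::finite, 'k::finite) inst \<Rightarrow> 'k box \<Rightarrow> ('n, 'k) bnb_state \<Rightarrow> ('n, 'k) bnb_state \<Rightarrow> bool"
  for I Q s where
  infeasible: "\<nexists>V. mer_feasible I Q V \<Longrightarrow> process_box I Q s s"
| feasible: "\<lbrakk>mer_optimal I Q V; L = mer_value I Q; x = hat_point I Q V\<rbrakk> \<Longrightarrow>
    process_box I Q s
      \<lparr>problems = (if L \<le> ereal (upper s) then add_mset (Q, V, L) (problems s) else problems s),
       upper = (if objective I x \<le> upper s then objective I x else upper s),
       incumbent = (if objective I x \<le> upper s then x else incumbent s)\<rparr>"

inductive bnb_step ::
  "('n::finite, 'k::finite) inst \<Rightarrow> real \<Rightarrow> ('n, 'k) bnb_state \<Rightarrow> ('n, 'k) bnb_state \<Rightarrow> bool"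
  for I \<epsilon> s where
  "\<lbrakk>least_node s (Q, V, L);
    \<not> ereal (upper s) - L < ereal \<epsilon>;
    \<forall>k. gap I Q V k \<le> gap I Q V k';
    (Q1, Q2) \<in> {(lower_half Q k', upper_half Q k'), (upper_half Q k', lower_half Q k')};
    process_box I Q1 (s\<lparr>problems := problems s - {#(Q, V, L)#}\<rparr>) s1;
    process_box I Q2 s1 s2\<rbrakk> \<Longrightarrow> bnb_step I \<epsilon> s s2"

text \<open>The \<open>t\<close>-th entry of a run is the state at the beginning of iteration \<open>t\<close>, so the length
  of a run is the number of iterations begun. If its last state satisfies \<^const>\<open>bnb_stops\<close>, the
  last iteration is the one in which the algorithm terminates and returns
  \<open>incumbent\<close>.\<close>

definition bnb_run ::
  "('n::finite, 'k::finite) inst \<Rightarrow> real \<Rightarrow> ('n, 'k) bnb_state list \<Rightarrow> bool" where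
  "bnb_run I \<epsilon> ss \<longleftrightarrow> ss \<noteq> [] \<and> bnb_init I (hd ss) \<and> successively (bnb_step I \<epsilon>) ss"

end

theory Submission
  imports Defs
begin

text \<open>
  If an iteration does not stop, the constructed point of the selected node exceeds its lower bound
  by at least \<open>\<epsilon>\<close>. That difference is the sum over \<open>k\<close> of the logarithms of one plus the gaps,
  so the largest gap is at least \<open>exp (\<epsilon> / K) - 1 = 2 \<delta>\<close>. A gap never exceeds the width of
  the corresponding interval, hence only intervals of width at least \<open>2 \<delta>\<close> are bisected. The size
  of a box, the product over \<open>k\<close> of \<open>max 1 (width / \<delta>)\<close>, is at least \<open>1\<close> and adds up under such
  bisections, so the sum of \<open>size - 1\<close> over the open nodes drops by at least \<open>1\<close> per iteration.
  Correctness rests on the invariant that every feasible point that is no worse than the incumbent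
  lies in the box of an open node; applied to the incumbent itself, it shows that open nodes remain.
\<close>

section \<open>Positive semidefinite matrices\<close>

definition qform :: "complex^'n^'n \<Rightarrow> complex^'n \<Rightarrow> real" where
  "qform A x = Re (\<Sum>i\<in>UNIV. cnj (x $ i) * (A *v x) $ i)"

lemma psd_mat_iff: "psd_mat A \<longleftrightarrow> hermitian_mat A \<and> (\<forall>x. 0 \<le> qform A x)"
  unfolding psd_mat_def qform_def ..

lemma qform_nonneg: "psd_mat A \<Longrightarrow> 0 \<le> qform A x"
  by (simp add: psd_mat_iff)

lemma hermitian_matD: "hermitian_mat A \<Longrightarrow> A $ i $ j = cnj (A $ j $ i)"
  unfolding hermitian_mat_def by blast

lemma qform_expand:
  "qform A x = (\<Sum>i\<in>UNIV. \<Sum>j\<in>UNIV. Re (cnj (x $ i) * A $ i $ j * x $ j))"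
  unfolding qform_def
  by (simp add: matrix_vector_mult_def sum_distrib_left mult.assoc del: times_complex.simps)

lemma qform_add: "qform (A + B) x = qform A x + qform B x"
  unfolding qform_def
  by (simp add: matrix_vector_mult_add_rdistrib distrib_left sum.distrib del: times_complex.simps)

lemma hermitian_mat_add: "hermitian_mat A \<Longrightarrow> hermitian_mat B \<Longrightarrow> hermitian_mat (A + B)"
  unfolding hermitian_mat_def by (metis complex_cnj_add vector_add_component)

lemma psd_mat_add: "psd_mat A \<Longrightarrow> psd_mat B \<Longrightarrow> psd_mat (A + B)"
  by (simp add: psd_mat_iff qform_add hermitian_mat_add)

lemma psd_mat_zero: "psd_mat 0"
  by (simp add: psd_mat_def hermitian_mat_def)

lemma psd_mat_sum: "(\<And>i. i \<in> S \<Longrightarrow> psd_mat (f i)) \<Longrightarrow> psd_mat (\<Sum>i\<in>S. f i)"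
  by (induction S rule: infinite_finite_induct) (auto intro: psd_mat_add psd_mat_zero)

lemma rtrace_diff: "rtrace (A - B) = rtrace A - rtrace B"
  by (simp add: rtrace_def trace_def sum_subtractf)

text \<open>Cyclicity of the trace. Signal and interference thus become quadratic forms in the
  channel vector.\<close>

lemma rtrace_outer_mat: "rtrace (outer_mat h ** A) = qform A h"
proof -
  have "trace (outer_mat h ** A) = (\<Sum>i\<in>UNIV. \<Sum>j\<in>UNIV. h $ i * cnj (h $ j) * A $ j $ i)"
    by (simp add: trace_def outer_mat_def matrix_matrix_mult_def)
  also have "\<dots> = (\<Sum>j\<in>UNIV. \<Sum>i\<in>UNIV. h $ i * cnj (h $ j) * A $ j $ i)"
    by (rule sum.swap)
  also have "\<dots> = (\<Sum>j\<in>UNIV. cnj (h $ j) * (A *v h) $ j)"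
    by (simp add: matrix_vector_mult_def sum_distrib_left mult_ac)
  finally show ?thesis
    by (simp add: rtrace_def qform_def)
qed

section \<open>Entries, norm and quadratic form of a positive semidefinite matrix bounded by its
  trace\<close>

lemma qform_two:
  fixes A :: "complex^'n^'n"
  assumes "i \<noteq> j"
  shows "qform A (\<chi> m. if m = i then a else if m = j then b else 0) =
    Re (cnj a * A $ i $ i * a) + Re (cnj a * A $ i $ j * b) +
    Re (cnj b * A $ j $ i * a) + Re (cnj b * A $ j $ j * b)"
proof -
  define x :: "complex^'n" where "x = (\<chi> m. if m = i then a else if m = j then b else 0)"
  have s: "(\<Sum>m\<in>UNIV. f m) = f i + f j" if "\<And>m. m \<noteq> i \<Longrightarrow> m \<noteq> j \<Longrightarrow> f m = 0"
    for f :: "'n \<Rightarrow> real"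
  proof -
    have "(\<Sum>m\<in>UNIV. f m) = (\<Sum>m\<in>{i, j}. f m)"
      by (rule sum.mono_neutral_right) (use that in auto)
    then show ?thesis
      using assms by simp
  qed
  have x: "x $ i = a" "x $ j = b" "\<And>m. m \<noteq> i \<Longrightarrow> m \<noteq> j \<Longrightarrow> x $ m = 0"
    using assms by (auto simp: x_def)
  have "qform A x = (\<Sum>m\<in>UNIV. Re (cnj (x $ m) * A $ m $ i * x $ i) +
      Re (cnj (x $ m) * A $ m $ j * x $ j))"
    unfolding qform_expand by (intro sum.cong refl s) (simp add: x)
  also have "\<dots> = (Re (cnj (x $ i) * A $ i $ i * x $ i) + Re (cnj (x $ i) * A $ i $ j * x $ j)) +
      (Re (cnj (x $ j) * A $ j $ i * x $ i) + Re (cnj (x $ j) * A $ j $ j * x $ j))"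
    by (rule s) (simp add: x)
  finally show ?thesis
    by (simp add: x flip: x_def)
qed

lemma qform_axis: "qform A (axis i 1) = Re (A $ i $ i)"
proof -
  have "cnj (axis i 1 $ j) * (A *v axis i 1) $ j = (if j = i then A $ i $ i else 0)" for j
    by (simp add: matrix_vector_mult_def axis_def if_distrib cong: if_cong)
  then show ?thesis
    by (simp add: qform_def)
qed

lemma psd_diag_nonneg: "psd_mat A \<Longrightarrow> 0 \<le> Re (A $ i $ i)"
  using qform_nonneg[of A "axis i 1"] by (simp add: qform_axis)

lemma rtrace_nonneg: "psd_mat A \<Longrightarrow> 0 \<le> rtrace A"
  by (simp add: rtrace_def trace_def sum_nonneg psd_diag_nonneg)

lemma psd_diag_le_rtrace:
  assumes "psd_mat A"
  shows "Re (A $ i $ i) \<le> rtrace A"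
proof -
  have "Re (A $ i $ i) \<le> (\<Sum>m\<in>UNIV. Re (A $ m $ m))"
    by (rule member_le_sum) (auto simp: assms psd_diag_nonneg)
  then show ?thesis
    by (simp add: rtrace_def trace_def)
qed

text \<open>The discriminant criterion: for positive \<open>a\<close> the parabola is evaluated at
  its vertex \<open>m / a\<close>; for \<open>a = 0\<close> a linear function bounded below has
  slope zero.\<close>

lemma nonneg_quadratic_imp:
  fixes a m d :: real
  assumes "\<And>t. 0 \<le> a * t\<^sup>2 - 2 * m * t + d" and "0 \<le> a"
  shows "m\<^sup>2 \<le> a * d"
proof (cases "a = 0")
  case True
  have "m = 0"
  proof (rule ccontr)
    assume "m \<noteq> 0"
    then show False
      using assms(1)[of "(d + 1) / (2 * m)"] True by simp
  qed
  then show ?thesis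
    using True by simp
next
  case False
  then have "0 < a"
    using assms by simp
  have "a * (m / a)\<^sup>2 - 2 * m * (m / a) + d = (a * d - m\<^sup>2) / a"
    using \<open>0 < a\<close> by (simp add: field_simps power2_eq_square)
  then have "0 \<le> (a * d - m\<^sup>2) / a"
    using assms(1)[of "m / a"] by simp
  then show ?thesis
    using \<open>0 < a\<close> by (simp add: zero_le_divide_iff)
qed

text \<open>Nonnegativity of the 2-by-2 principal minors. Off the diagonal, the form is tested on
  vectors supported on \<open>i\<close> and \<open>j\<close>, with a real entry \<open>t\<close> and
  an entry \<open>c\<close> that turns the mixed terms into \<open>- 2 * norm w * t\<close>; the
  discriminant does the rest.\<close>

lemma psd_entry_le:
  assumes "psd_mat A"
  shows "norm (A $ i $ j) \<le> sqrt (Re (A $ i $ i)) * sqrt (Re (A $ j $ j))"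
proof (cases "i = j")
  case True
  have "Im (A $ i $ i) = 0"
    using hermitian_matD[of A i i] assms unfolding psd_mat_def by (auto simp: complex_eq_iff)
  then have "norm (A $ i $ i) = \<bar>Re (A $ i $ i)\<bar>"
    by (simp add: norm_complex_def)
  then show ?thesis
    using True psd_diag_nonneg[OF assms] by simp
next
  case False
  define w where "w = A $ i $ j"
  have ji: "A $ j $ i = cnj w"
    unfolding w_def using assms by (intro hermitian_matD) (simp add: psd_mat_def)
  have Re_mult: "Re (complex_of_real r * z) = r * Re z" for r z
    by simp
  \<comment> \<open>If \<open>w = 0\<close>, then \<open>sgn w = 0\<close> and \<open>c\<close>
    vanishes instead of having modulus 1. Hence \<open>cc\<close> relies only on
    \<open>norm c \<le> 1\<close>.\<close>
  define c where "c = - cnj (sgn w)"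
  have cw: "c * w = - complex_of_real (norm w)"
    using complex_norm_square[of w]
    by (cases "w = 0") (auto simp: c_def sgn_eq field_simps power2_eq_square)
  have cc: "Re (c * z * cnj c) \<le> Re z" if "0 \<le> Re z" for z
  proof -
    have "c * z * cnj c = complex_of_real ((norm c)\<^sup>2) * z"
      unfolding complex_norm_square by (simp add: mult_ac)
    moreover have "(norm c)\<^sup>2 \<le> 1"
      by (simp add: c_def norm_sgn)
    ultimately show ?thesis
      using that mult_left_le_one_le[of "Re z" "(norm c)\<^sup>2"] by (simp only: Re_mult) simp
  qed
  have "0 \<le> Re (A $ i $ i) * t\<^sup>2 - 2 * norm w * t + Re (A $ j $ j)" for t :: real
  proof -
    have "0 \<le> qform A (\<chi> m. if m = i then of_real t else if m = j then c else 0)"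
      by (rule qform_nonneg[OF assms])
    also have "\<dots> = Re (A $ i $ i) * t\<^sup>2 + t * Re (c * w) + t * Re (cnj (c * w)) +
        Re (c * A $ j $ j * cnj c)"
      unfolding qform_two[OF False] ji w_def[symmetric]
      by (simp add: power2_eq_square algebra_simps)
    also have "\<dots> \<le> Re (A $ i $ i) * t\<^sup>2 - 2 * norm w * t + Re (A $ j $ j)"
      using cc[OF psd_diag_nonneg[OF assms], of j] by (simp add: cw)
    finally show ?thesis .
  qed
  then have "(norm w)\<^sup>2 \<le> Re (A $ i $ i) * Re (A $ j $ j)"
    by (rule nonneg_quadratic_imp) (rule psd_diag_nonneg[OF assms])
  then show ?thesis
    by (simp add: w_def real_le_rsqrt flip: real_sqrt_mult)
qed

lemma psd_entry_le_rtrace: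
  assumes "psd_mat A"
  shows "norm (A $ i $ j) \<le> rtrace A"
proof -
  have "norm (A $ i $ j) \<le> sqrt (Re (A $ i $ i)) * sqrt (Re (A $ j $ j))"
    by (rule psd_entry_le[OF assms])
  also have "\<dots> \<le> sqrt (rtrace A) * sqrt (rtrace A)"
    by (intro mult_mono real_sqrt_le_mono psd_diag_le_rtrace)
      (auto simp: assms psd_diag_nonneg rtrace_nonneg)
  finally show ?thesis
    by (simp add: rtrace_nonneg[OF assms])
qed

text \<open>The constant is crude: it only has to give boundedness for the compactness
  argument.\<close>

lemma norm_mat_le:
  fixes A :: "complex^'n^'m"
  assumes "\<And>i j. norm (A $ i $ j) \<le> c"
  shows "norm A \<le> real CARD('m) * (real CARD('n) * c)"
proof -
  have "norm (A $ i) \<le> real CARD('n) * c" for i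
  proof -
    have "norm (A $ i) \<le> (\<Sum>j\<in>UNIV. norm (A $ i $ j))"
      by (simp add: norm_vec_def L2_set_le_sum)
    also have "\<dots> \<le> (\<Sum>j\<in>(UNIV :: 'n set). c)"
      by (intro sum_mono assms)
    finally show ?thesis
      by simp
  qed
  then have "(\<Sum>i\<in>UNIV. norm (A $ i)) \<le> (\<Sum>i\<in>(UNIV :: 'm set). real CARD('n) * c)"
    by (intro sum_mono)
  moreover have "norm A \<le> (\<Sum>i\<in>UNIV. norm (A $ i))"
    by (simp add: norm_vec_def L2_set_le_sum)
  ultimately show ?thesis
    by simp
qed

lemma norm_psd_le:
  fixes A :: "complex^'n^'n"
  assumes "psd_mat A" and "rtrace A \<le> c"
  shows "norm A \<le> real CARD('n) * (real CARD('n) * c)"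
  by (rule norm_mat_le) (use psd_entry_le_rtrace[OF assms(1)] assms(2) in \<open>blast intro: order_trans\<close>)

text \<open>By \<open>psd_entry_le\<close> the double sum is at most the square of a single sum,
  which Cauchy-Schwarz splits into the two factors. The constant 1 is what makes
  \<open>int_bound\<close> a valid bound.\<close>

lemma qform_le_rtrace:
  assumes "psd_mat A"
  shows "qform A x \<le> (norm x)\<^sup>2 * rtrace A"
proof -
  let ?d = "\<lambda>i. sqrt (Re (A $ i $ i))"
  have "qform A x \<le> (\<Sum>i\<in>UNIV. \<Sum>j\<in>UNIV. (norm (x $ i) * ?d i) * (norm (x $ j) * ?d j))"
    unfolding qform_expand
  proof (intro sum_mono)
    fix i j
    have "Re (cnj (x $ i) * A $ i $ j * x $ j) \<le> norm (cnj (x $ i) * A $ i $ j * x $ j)"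
      by (rule complex_Re_le_cmod)
    also have "\<dots> = norm (x $ i) * norm (A $ i $ j) * norm (x $ j)"
      by (simp add: norm_mult)
    also have "\<dots> \<le> norm (x $ i) * (?d i * ?d j) * norm (x $ j)"
      by (intro mult_right_mono mult_left_mono psd_entry_le assms) auto
    finally show "Re (cnj (x $ i) * A $ i $ j * x $ j) \<le> (norm (x $ i) * ?d i) * (norm (x $ j) * ?d j)"
      by (simp add: mult_ac)
  qed
  also have "\<dots> = (\<Sum>i\<in>UNIV. norm (x $ i) * ?d i)\<^sup>2"
    by (simp add: power2_eq_square sum_product)
  also have "\<dots> \<le> (\<Sum>i\<in>UNIV. (norm (x $ i))\<^sup>2) * (\<Sum>i\<in>UNIV. (?d i)\<^sup>2)"
    by (rule Cauchy_Schwarz_ineq_sum)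
  also have "(\<Sum>i\<in>UNIV. (norm (x $ i))\<^sup>2) = (norm x)\<^sup>2"
    by (simp add: norm_vec_def L2_set_def sum_nonneg)
  also have "(\<Sum>i\<in>UNIV. (?d i)\<^sup>2) = rtrace A"
    by (simp add: psd_diag_nonneg[OF assms] rtrace_def trace_def)
  finally show ?thesis .
qed

text \<open>The conjugate transpose \<open>Y\<close> of \<open>X\<close> is a left inverse of
  \<open>R\<close>, so it equals the right inverse \<open>X\<close>, which is therefore Hermitian.
  Substituting \<open>x = R *v y\<close> turns the form of \<open>X\<close> at \<open>x\<close> into
  the form of \<open>R\<close> at \<open>y\<close>.\<close>

lemma psd_mat_inverse:
  fixes R X :: "complex^'n^'n"
  assumes "psd_mat R" and RX: "R ** X = mat 1"
  shows "psd_mat X"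
proof -
  define Y :: "complex^'n^'n" where "Y = (\<chi> i j. cnj (X $ j $ i))"
  have "(Y ** R) $ i $ j = (mat 1 :: complex^'n^'n) $ i $ j" for i j
  proof -
    have R: "R $ k $ j = cnj (R $ j $ k)" for k
      using assms(1) by (intro hermitian_matD) (simp add: psd_mat_def)
    have "(Y ** R) $ i $ j = (\<Sum>k\<in>UNIV. cnj (X $ k $ i) * R $ k $ j)"
      by (simp add: matrix_matrix_mult_def Y_def)
    also have "\<dots> = (\<Sum>k\<in>UNIV. cnj (R $ j $ k * X $ k $ i))"
      by (simp add: R mult.commute)
    also have "\<dots> = cnj ((R ** X) $ j $ i)"
      by (simp add: matrix_matrix_mult_def)
    finally show ?thesis
      by (auto simp: RX mat_def)
  qed
  then have "Y ** R = mat 1"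
    by (simp add: vec_eq_iff)
  then have "Y = X"
    by (metis RX matrix_mul_assoc matrix_mul_lid matrix_mul_rid)
  then have "hermitian_mat X"
    unfolding hermitian_mat_def Y_def by (metis vec_lambda_beta)
  moreover have "0 \<le> qform X x" for x
  proof -
    define y where "y = X *v x"
    have x: "x = R *v y"
      by (simp add: y_def matrix_vector_mul_assoc RX)
    have "qform X x = Re (\<Sum>i\<in>UNIV. cnj ((R *v y) $ i) * y $ i)"
      by (simp add: qform_def y_def[symmetric] x[symmetric])
    also have "\<dots> = Re (cnj (\<Sum>i\<in>UNIV. cnj ((R *v y) $ i) * y $ i))"
      by simp
    also have "\<dots> = qform R y"
      by (simp add: qform_def mult.commute)
    finally show ?thesis
      by (simp add: qform_nonneg[OF assms(1)])
  qed
  ultimately show ?thesis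
    by (simp add: psd_mat_iff)
qed

lemma matrix_inv_right:
  fixes A :: "complex^'n^'n"
  assumes "invertible A"
  shows "A ** matrix_inv A = mat 1"
  using assms unfolding invertible_def matrix_inv_def by (rule someI2_ex) simp

lemma matrix_inv_eqI:
  fixes A B :: "complex^'n^'n"
  assumes "A ** B = mat 1"
  shows "invertible A" and "matrix_inv A = B"
proof -
  have BA: "B ** A = mat 1"
    using assms matrix_left_right_inverse by blast
  then show inv: "invertible A"
    using assms by (auto simp: invertible_def)
  show "matrix_inv A = B"
    by (metis BA inv matrix_inv_right matrix_mul_assoc matrix_mul_lid matrix_mul_rid)
qed

section \<open>Continuity and closedness\<close>

lemma continuous_on_matrix_mult:
  fixes f g :: "'z::topological_space \<Rightarrow> complex^'n^'n"
  assumes "continuous_on S f" "continuous_on S g"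
  shows "continuous_on S (\<lambda>z. f z ** g z)"
  unfolding matrix_matrix_mult_def by (intro continuous_intros assms)

lemma continuous_on_rtrace:
  assumes "continuous_on S f"
  shows "continuous_on S (\<lambda>z. rtrace (f z))"
  unfolding rtrace_def trace_def by (intro continuous_intros assms)

lemma closed_Collect_psd:
  fixes f :: "'z::topological_space \<Rightarrow> complex^'n^'n"
  assumes "continuous_on UNIV f"
  shows "closed {z. psd_mat (f z)}"
  unfolding psd_mat_def hermitian_mat_def matrix_vector_mult_def
  by (simp del: times_complex.simps Re_sum,
      intro closed_Collect_conj closed_Collect_all closed_Collect_eq closed_Collect_le
        continuous_intros assms)

section \<open>The problem and its relaxation\<close>

lemma psd_beam: "common_constraints I p \<Longrightarrow> psd_mat (beam p k)"
  by (simp add: common_constraints_def loewner_le_def)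

lemma psd_covX:
  assumes "common_constraints I p"
  shows "psd_mat (covX p)"
proof -
  have "psd_mat ((covX p - (\<Sum>k\<in>UNIV. beam p k)) + (\<Sum>k\<in>UNIV. beam p k))"
    using assms
    by (intro psd_mat_add psd_mat_sum psd_beam)
      (auto simp: common_constraints_def loewner_le_def)
  then show ?thesis
    by simp
qed

text \<open>The difference is the Loewner slack plus the beams of the other users.\<close>

lemma psd_covX_minus_beam:
  assumes "common_constraints I p"
  shows "psd_mat (covX p - beam p k)"
proof -
  have "psd_mat ((covX p - (\<Sum>j\<in>UNIV. beam p j)) + (\<Sum>j\<in>UNIV - {k}. beam p j))"
    using assms
    by (intro psd_mat_add psd_mat_sum psd_beam)
      (auto simp: common_constraints_def loewner_le_def)
  moreover have "(\<Sum>j\<in>UNIV. beam p j) = beam p k + (\<Sum>j\<in>UNIV - {k}. beam p j)"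
    by (simp add: sum.remove)
  ultimately show ?thesis
    by (simp add: algebra_simps)
qed

lemma rtrace_Qmat: "rtrace (Qmat I k ** A) = qform A (channel I k)"
  by (simp add: Qmat_def rtrace_outer_mat)

lemma interference_eq: "interference I p k = qform (covX p - beam p k) (channel I k)"
  by (simp add: interference_def rtrace_Qmat)

lemma interference_nonneg: "common_constraints I p \<Longrightarrow> 0 \<le> interference I p k"
  by (simp add: interference_eq qform_nonneg psd_covX_minus_beam)

lemma qform_le_int_bound:
  assumes "psd_mat A" and "rtrace A \<le> budget I"
  shows "qform A (channel I k) \<le> int_bound I k"
proof -
  have "qform A (channel I k) \<le> (norm (channel I k))\<^sup>2 * rtrace A"
    by (rule qform_le_rtrace[OF assms(1)])
  also have "\<dots> \<le> (norm (channel I k))\<^sup>2 * budget I"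
    by (intro mult_left_mono assms) simp
  finally show ?thesis
    by (simp add: int_bound_def mult.commute)
qed

lemma rtrace_beam_le:
  assumes "common_constraints I p"
  shows "rtrace (beam p k) \<le> budget I"
  using rtrace_nonneg[OF psd_covX_minus_beam[OF assms, of k]] assms
  by (simp add: rtrace_diff common_constraints_def)

lemma interference_le:
  assumes "common_constraints I p"
  shows "interference I p k \<le> int_bound I k"
  unfolding interference_eq
proof (rule qform_le_int_bound[OF psd_covX_minus_beam[OF assms]])
  have "rtrace (covX p) \<le> budget I"
    using assms by (simp add: common_constraints_def)
  then show "rtrace (covX p - beam p k) \<le> budget I"
    using rtrace_nonneg[OF psd_beam[OF assms, of k]] by (simp add: rtrace_diff)
qed

lemma signal_nonneg: "common_constraints I p \<Longrightarrow> 0 \<le> rtrace (Qmat I k ** beam p k)"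
  by (simp add: rtrace_Qmat qform_nonneg psd_beam)

lemma signal_le:
  "common_constraints I p \<Longrightarrow> rtrace (Qmat I k ** beam p k) \<le> int_bound I k"
  by (simp add: rtrace_Qmat qform_le_int_bound psd_beam rtrace_beam_le)

text \<open>At SINR zero the constraint only asks for a nonnegative signal power, and raising an
  SINR lowers the objective. This justifies that \<open>init_box\<close> has lower ends 0.\<close>

lemma P_feasible_pos_part:
  assumes "P_feasible I p"
  defines "p' \<equiv> p\<lparr>sinr := \<lambda>k. max 0 (sinr p k)\<rparr>"
  shows "P_feasible I p'" and "objective I p' \<le> objective I p"
proof -
  have cc: "common_constraints I p"
    using assms by (simp add: P_feasible_def)
  have "common_constraints I p'"
    using cc by (auto simp: common_constraints_def p'_def)
  moreover have "rtrace (Qmat I k ** beam p' k) - sinr p' k * interference I p' k \<ge> sinr p' k * noise I"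
    for k
    using assms(1) signal_nonneg[OF cc, of k]
    by (auto simp: P_feasible_def p'_def max_def interference_def)
  ultimately show "P_feasible I p'"
    by (simp add: P_feasible_def)
  have "(\<Sum>k\<in>UNIV. ln (1 + sinr p k)) \<le> (\<Sum>k\<in>UNIV. ln (1 + sinr p' k))"
  proof (rule sum_mono)
    fix k
    have "sinr p k > -1"
      using cc by (simp add: common_constraints_def)
    then show "ln (1 + sinr p k) \<le> ln (1 + sinr p' k)"
      by (simp add: p'_def)
  qed
  then show "objective I p' \<le> objective I p"
    by (simp add: objective_def p'_def)
qed

text \<open>Interference is nonnegative, so \<open>sinr p k * noise I\<close> is at most the signal
  power. This yields the upper ends of \<open>init_box\<close>.\<close>

lemma P_feasible_sinr_le:
  assumes "P_feasible I p" and "noise I > 0" and "0 \<le> sinr p k"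
  shows "sinr p k \<le> budget I * (norm (channel I k))\<^sup>2 / noise I"
proof -
  have cc: "common_constraints I p"
    using assms by (simp add: P_feasible_def)
  have "sinr p k * noise I \<le> rtrace (Qmat I k ** beam p k) - sinr p k * interference I p k"
    using assms by (simp add: P_feasible_def)
  also have "\<dots> \<le> int_bound I k"
    using signal_le[OF cc, of k] interference_nonneg[OF cc, of k] assms(3)
    by (smt (verit) mult_nonneg_nonneg)
  finally show ?thesis
    using assms(2) by (simp add: int_bound_def field_simps)
qed

lemma mat_mult_mat: "(mat a :: complex^'n^'n) ** mat b = mat (a * b)"
proof -
  have "((mat a :: complex^'n^'n) ** mat b) $ i $ j = (mat (a * b) :: complex^'n^'n) $ i $ j" for i j
  proof -
    have "(mat a :: complex^'n^'n) $ i $ k * (mat b :: complex^'n^'n) $ k $ j =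
        (if k = i then (mat (a * b) :: complex^'n^'n) $ i $ j else 0)" for k
      by (simp add: mat_def)
    then show ?thesis
      by (simp add: matrix_matrix_mult_def)
  qed
  then show ?thesis
    by (simp add: vec_eq_iff)
qed

text \<open>Witness: the multiple of the identity with trace equal to the budget, with zero beams.
  It makes the first relaxation feasible, so that the algorithm can start.\<close>

lemma P_feasible_exists:
  fixes I :: "('n::finite, 'k::finite) inst"
  assumes "budget I > 0"
  shows "\<exists>p. P_feasible I p \<and> (\<forall>k. sinr p k = 0)"
proof -
  define c where "c = budget I / real CARD('n)"
  have "c > 0"
    using assms by (simp add: c_def)
  define R :: "complex^'n^'n" where "R = mat (of_real c)"
  have "R ** mat (1 / of_real c) = mat 1"
    using \<open>c > 0\<close> by (simp add: R_def mat_mult_mat)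
  then have "invertible R"
    by (rule matrix_inv_eqI)
  have herm: "hermitian_mat R"
    by (simp add: hermitian_mat_def R_def mat_def)
  have "0 \<le> qform R x" for x
  proof -
    have "R *v x = (\<chi> i. of_real c * x $ i)"
    proof -
      have "R $ i $ j * x $ j = (if j = i then of_real c * x $ i else 0)" for i j
        by (simp add: R_def mat_def)
      then show ?thesis
        by (simp add: matrix_vector_mult_def)
    qed
    then have "qform R x = (\<Sum>i\<in>UNIV. c * Re (cnj (x $ i) * x $ i))"
      by (simp add: qform_def algebra_simps)
    then show ?thesis
      using \<open>c > 0\<close> by (simp add: sum_nonneg)
  qed
  then have psd: "psd_mat R"
    using herm by (simp add: psd_mat_iff)
  define p :: "('n, 'k) point" where "p = \<lparr>covX = R, sinr = \<lambda>_. 0, beam = \<lambda>_. 0\<rparr>"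
  have "rtrace R \<le> budget I"
    by (simp add: rtrace_def trace_def R_def mat_def c_def)
  then have "common_constraints I p"
    using herm \<open>invertible R\<close> psd psd_mat_zero
    by (simp add: common_constraints_def p_def loewner_le_def psd_mat_def)
  then have "P_feasible I p"
    by (simp add: P_feasible_def p_def rtrace_def trace_def)
  then show ?thesis
    by (auto simp: p_def)
qed

section \<open>The relaxation over a box and the constructed point\<close>

definition in_box :: "'k box \<Rightarrow> ('n::finite, 'k::finite) point \<Rightarrow> bool" where
  "in_box Q p \<longleftrightarrow> (\<forall>k. fst (Q k) \<le> sinr p k \<and> sinr p k \<le> snd (Q k))"

text \<open>In the relaxation the slack stands for the product of SINR and interference; here it
  takes the exact value of that product.\<close>

definition mer_of :: "('n::finite, 'k::finite) inst \<Rightarrow> ('n, 'k) point \<Rightarrow> ('n, 'k) mer_point" where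
  "mer_of I p = \<lparr>covX = covX p, sinr = sinr p, beam = beam p,
     slack = (\<lambda>k. sinr p k * interference I p k)\<rparr>"

lemma objective_mer_of: "objective I (mer_of I p) = objective I p"
  by (simp add: objective_def mer_of_def)

text \<open>The McCormick envelope contains the exact product: two of its bounds come from
  multiplying \<open>l \<le> g\<close> and \<open>g \<le> u\<close> by \<open>i\<close>, the other
  two from expanding products of nonnegative distances to the ends of the ranges.\<close>

lemma mer_feasible_mer_of:
  assumes "P_feasible I p" and "in_box Q p"
  shows "mer_feasible I Q (mer_of I p)"
proof -
  have cc: "common_constraints I p"
    using assms by (simp add: P_feasible_def)
  have "common_constraints I (mer_of I p)"
    using cc by (simp add: common_constraints_def mer_of_def)
  moreover have
    "l * i \<le> g * i \<and> u * i + (g - u) * b \<le> g * i \<and> g * i \<le> u * i \<and> g * i \<le> (g - l) * b + l * i"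
    if "l \<le> g" "g \<le> u" "0 \<le> i" "i \<le> b" for l u g i b :: real
  proof -
    have "0 \<le> (u - g) * (b - i)" "0 \<le> (g - l) * (b - i)"
      using that by auto
    then show ?thesis
      using that by (intro conjI mult_right_mono) (auto simp: algebra_simps)
  qed
  moreover have "fst (Q k) \<le> sinr p k" "sinr p k \<le> snd (Q k)" for k
    using assms(2) by (simp_all add: in_box_def)
  moreover have "rtrace (Qmat I k ** beam p k) - sinr p k * interference I p k \<ge> sinr p k * noise I"
    for k
    using assms(1) by (simp add: P_feasible_def)
  moreover have sel: "sinr (mer_of I p) = sinr p" "beam (mer_of I p) = beam p"
    "slack (mer_of I p) = (\<lambda>k. sinr p k * interference I p k)"
    "interference I (mer_of I p) = interference I p"
    by (simp_all add: mer_of_def interference_def fun_eq_iff)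
  ultimately show ?thesis
    using interference_nonneg[OF cc] interference_le[OF cc]
    unfolding mer_feasible_def Let_def sel by blast
qed

text \<open>\<open>hat_sinr\<close> is the average of \<open>sinr V k\<close> and the lower end of
  the interval, weighted by noise and interference.\<close>

lemma hat_sinr_bounds:
  assumes "mer_feasible I Q V" and "noise I > 0"
  shows "fst (Q k) \<le> hat_sinr I Q V k" and "hat_sinr I Q V k \<le> sinr V k"
proof -
  let ?i = "interference I V k"
  have V: "fst (Q k) \<le> sinr V k" "0 \<le> ?i"
    using assms by (simp_all add: mer_feasible_def Let_def)
  then have pos: "noise I + ?i > 0"
    using assms by simp
  show "fst (Q k) \<le> hat_sinr I Q V k"
    using pos mult_right_mono[OF V(1), of "noise I"] assms(2)
    by (simp add: hat_sinr_def pos_le_divide_eq algebra_simps)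
  show "hat_sinr I Q V k \<le> sinr V k"
    using pos mult_right_mono[OF V]
    by (simp add: hat_sinr_def pos_divide_le_eq algebra_simps)
qed

text \<open>After clearing the denominator of \<open>hat_sinr\<close>, the SINR constraint follows
  from the envelope bound \<open>s \<ge> l * i\<close> and the linearised constraint of the
  relaxation.\<close>

lemma P_feasible_hat_point:
  assumes "mer_feasible I Q V" and "noise I > 0" and "\<And>k. 0 \<le> fst (Q k)"
  shows "P_feasible I (hat_point I Q V)"
proof -
  let ?p = "hat_point I Q V"
  have cc: "common_constraints I V"
    using assms by (simp add: mer_feasible_def)
  have h0: "0 \<le> hat_sinr I Q V k" for k
    using hat_sinr_bounds(1)[OF assms(1,2)] assms(3) by (rule order_trans[rotated])
  have "common_constraints I ?p"
    using cc h0 by (force simp: common_constraints_def hat_point_def intro: less_le_trans[of _ 0])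
  moreover have "rtrace (Qmat I k ** beam V k) - hat_sinr I Q V k * interference I V k
      \<ge> hat_sinr I Q V k * noise I" for k
  proof -
    have "noise I + interference I V k > 0"
      using interference_nonneg[OF cc, of k] assms(2) by simp
    then have "hat_sinr I Q V k * (noise I + interference I V k) =
        sinr V k * noise I + fst (Q k) * interference I V k"
      by (simp add: hat_sinr_def)
    also have "\<dots> \<le> sinr V k * noise I + slack V k"
      using assms(1) by (simp add: mer_feasible_def Let_def)
    also have "\<dots> \<le> rtrace (Qmat I k ** beam V k)"
      using assms(1) unfolding mer_feasible_def Let_def by (smt (verit))
    finally show ?thesis
      by (simp add: algebra_simps)
  qed
  ultimately show ?thesis
    by (simp add: P_feasible_def hat_point_def interference_def)
qed

text \<open>The denominator of the gap is at least 1, since \<open>hat_sinr\<close> lies above a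
  nonnegative lower end; the numerator is a distance between two points of the interval.\<close>

lemma gap_le_width:
  assumes "mer_feasible I Q V" and "noise I > 0" and "\<And>k. 0 \<le> fst (Q k)"
  shows "gap I Q V k \<le> snd (Q k) - fst (Q k)"
proof -
  have h: "fst (Q k) \<le> hat_sinr I Q V k" "hat_sinr I Q V k \<le> sinr V k"
    using hat_sinr_bounds[OF assms(1,2)] by auto
  have "gap I Q V k \<le> (sinr V k - hat_sinr I Q V k) / 1"
    unfolding gap_def using h assms(3)[of k] by (intro divide_left_mono) auto
  also have "\<dots> \<le> snd (Q k) - fst (Q k)"
  proof -
    have "sinr V k \<le> snd (Q k)"
      using assms(1) by (simp add: mer_feasible_def Let_def)
    then show ?thesis
      using h by simp
  qed
  finally show ?thesis .
qed

text \<open>The covariances agree, so the trace terms cancel, and \<open>1 + gap\<close> is the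
  quotient of \<open>1 + sinr\<close> and \<open>1 + hat_sinr\<close>.\<close>

lemma objective_hat_point_minus:
  assumes "mer_feasible I Q V" and "noise I > 0" and "\<And>k. 0 \<le> fst (Q k)"
  shows "objective I (hat_point I Q V) - objective I V = (\<Sum>k\<in>UNIV. ln (1 + gap I Q V k))"
proof -
  have "ln (1 + sinr V k) - ln (1 + hat_sinr I Q V k) = ln (1 + gap I Q V k)" for k
  proof -
    have "0 \<le> hat_sinr I Q V k" "hat_sinr I Q V k \<le> sinr V k"
      using hat_sinr_bounds[OF assms(1,2), of k] assms(3)[of k] by auto
    moreover from this have "1 + gap I Q V k = (1 + sinr V k) / (1 + hat_sinr I Q V k)"
      by (simp add: gap_def field_simps)
    ultimately show ?thesis
      by (simp add: ln_div)
  qed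
  then show ?thesis
    by (simp add: objective_def hat_point_def flip: sum_subtractf)
qed

lemma max_gap_ge:
  fixes I :: "('n::finite, 'k::finite) inst"
  assumes "mer_feasible I Q V" and "noise I > 0" and "\<And>k. 0 \<le> fst (Q k)"
    and max: "\<And>k. gap I Q V k \<le> gap I Q V k'"
    and "\<epsilon> \<le> objective I (hat_point I Q V) - objective I V"
  shows "exp (\<epsilon> / real CARD('k)) - 1 \<le> gap I Q V k'"
proof -
  have g0: "0 \<le> gap I Q V k" for k
  proof -
    have "0 \<le> hat_sinr I Q V k" "hat_sinr I Q V k \<le> sinr V k"
      using hat_sinr_bounds[OF assms(1,2), of k] assms(3)[of k] by auto
    then show ?thesis
      by (simp add: gap_def)
  qed
  have "\<epsilon> \<le> (\<Sum>k\<in>UNIV. ln (1 + gap I Q V k))"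
    using assms(5) objective_hat_point_minus[OF assms(1-3)] by simp
  also have "\<dots> \<le> (\<Sum>k\<in>(UNIV :: 'k set). ln (1 + gap I Q V k'))"
  proof (rule sum_mono)
    fix k
    show "ln (1 + gap I Q V k) \<le> ln (1 + gap I Q V k')"
      using g0[of k] max[of k] by simp
  qed
  finally have "\<epsilon> / real CARD('k) \<le> ln (1 + gap I Q V k')"
    by (simp add: pos_divide_le_eq mult.commute)
  then have "exp (\<epsilon> / real CARD('k)) \<le> 1 + gap I Q V k'"
    using g0[of k'] by (simp add: ln_ge_iff)
  then show ?thesis
    by simp
qed

section \<open>Existence of optimal solutions of the relaxation\<close>

text \<open>Every condition on the right except invertibility is closed. The strict bound on the
  SINRs is recovered from the nonnegative lower ends, hermiticity from positivity.\<close>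

lemma mer_feasible_iff:
  fixes V :: "('n::finite, 'k::finite) mer_point"
  assumes "\<And>k. 0 \<le> fst (Q k)"
  shows "mer_feasible I Q V \<longleftrightarrow>
     psd_mat (covX V) \<and> invertible (covX V) \<and> rtrace (covX V) \<le> budget I \<and>
     psd_mat (covX V - (\<Sum>k\<in>UNIV. beam V k)) \<and>
     (\<forall>k. let l = fst (Q k); u = snd (Q k); b = int_bound I k;
              g = sinr V k; s = slack V k; i = rtrace (Qmat I k ** (covX V - beam V k))
          in psd_mat (beam V k) \<and> g * noise I \<le> rtrace (Qmat I k ** beam V k) - s \<and>
             l \<le> g \<and> g \<le> u \<and> 0 \<le> i \<and> i \<le> b \<and>
             l * i \<le> s \<and> u * i + (g - u) * b \<le> s \<and>
             s \<le> u * i \<and> s \<le> (g - l) * b + l * i)"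
proof -
  have herm: "hermitian_mat A" if "psd_mat A" for A :: "complex^'n^'n"
    using that by (simp add: psd_mat_def)
  have "common_constraints I V \<longleftrightarrow>
     psd_mat (covX V) \<and> invertible (covX V) \<and> rtrace (covX V) \<le> budget I \<and>
     psd_mat (covX V - (\<Sum>k\<in>UNIV. beam V k)) \<and> (\<forall>k. -1 < sinr V k \<and> psd_mat (beam V k))"
    using psd_covX[of I V] herm by (auto simp: common_constraints_def loewner_le_def)
  moreover have "-1 < sinr V k" if "fst (Q k) \<le> sinr V k" for k
    using assms[of k] that by simp
  ultimately show ?thesis
    unfolding mer_feasible_def Let_def interference_def by blast
qed

text \<open>The inverse of the covariance is carried along as a variable of its own, bounded by its trace:
  this keeps the constraints closed and the objective continuous on a compact set.\<close>

lemma mer_optimal_exists: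
  fixes I :: "('n::finite, 'k::finite) inst"
  assumes "weight I > 0" and Q0: "\<And>k. 0 \<le> fst (Q k)" and V0: "mer_feasible I Q V0"
  shows "\<exists>V. mer_optimal I Q V"
proof -
  define mk :: "(complex^'n^'n) \<times> (complex^'n^'n) \<times> (real^'k) \<times> (complex^'n^'n^'k) \<times> (real^'k)
      \<Rightarrow> ('n, 'k) mer_point" where
    "mk = (\<lambda>(R, X, g, W, s). \<lparr>covX = R, sinr = ($) g, beam = ($) W, slack = ($) s\<rparr>)"
  define enc :: "('n, 'k) mer_point \<Rightarrow> _" where
    "enc V = (covX V, matrix_inv (covX V), \<chi> k. sinr V k, \<chi> k. beam V k, \<chi> k. slack V k)"
    for V
  have mk_enc: "mk (enc V) = V" for V
    by (simp add: mk_def enc_def vec_lambda_inverse)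
  \<comment> \<open>Bounds the trace of the inverse at any relaxation point no worse than
    \<open>V0\<close>: the logarithms are at most those at the upper ends of the box.\<close>
  define c where "c = (objective I V0 + (\<Sum>k\<in>UNIV. ln (1 + snd (Q k)))) / weight I"
  define C where "C = real CARD('n) * (real CARD('n) * c)"
  \<comment> \<open>The equation identifies the second component as the inverse. The norm bound
    makes the set bounded but keeps every point no worse than \<open>V0\<close>.\<close>
  define S where "S = {z. fst z ** fst (snd z) = mat 1 \<and> norm (fst (snd z)) \<le> C \<and> mer_feasible I Q (mk z)}"

  have enc_in_S: "enc V \<in> S" if V: "mer_feasible I Q V" and le: "objective I V \<le> objective I V0" for V
  proof -
    have inv: "covX V ** matrix_inv (covX V) = mat 1"
      using V by (intro matrix_inv_right) (simp add: mer_feasible_def common_constraints_def)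
    have psd: "psd_mat (matrix_inv (covX V))"
      using V inv by (intro psd_mat_inverse[OF psd_covX]) (auto simp: mer_feasible_def)
    have "(\<Sum>k\<in>UNIV. ln (1 + sinr V k)) \<le> (\<Sum>k\<in>UNIV. ln (1 + snd (Q k)))"
    proof (rule sum_mono)
      fix k
      have "fst (Q k) \<le> sinr V k" "sinr V k \<le> snd (Q k)"
        using V by (simp_all add: mer_feasible_def Let_def)
      then show "ln (1 + sinr V k) \<le> ln (1 + snd (Q k))"
        using Q0[of k] by simp
    qed
    then have "weight I * rtrace (matrix_inv (covX V)) \<le> weight I * c"
      using le assms(1) by (simp add: objective_def c_def)
    then have "rtrace (matrix_inv (covX V)) \<le> c"
      using assms(1) by simp
    then have "norm (matrix_inv (covX V)) \<le> C"
      unfolding C_def by (rule norm_psd_le[OF psd])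
    then show ?thesis
      using inv V by (simp add: S_def mk_enc) (simp add: enc_def)
  qed

  \<comment> \<open>Invertibility follows from the first equation, so only closed conditions
    remain.\<close>
  have S_eq: "S = {z. fst z ** fst (snd z) = mat 1 \<and> norm (fst (snd z)) \<le> C \<and>
      psd_mat (fst z) \<and> rtrace (fst z) \<le> budget I \<and>
      psd_mat (fst z - (\<Sum>k\<in>UNIV. fst (snd (snd (snd z))) $ k)) \<and>
      (\<forall>k. let l = fst (Q k); u = snd (Q k); b = int_bound I k;
              g = fst (snd (snd z)) $ k; s = snd (snd (snd (snd z))) $ k;
              W = fst (snd (snd (snd z))) $ k;
              i = rtrace (Qmat I k ** (fst z - W))
          in psd_mat W \<and> g * noise I \<le> rtrace (Qmat I k ** W) - s \<and>
             l \<le> g \<and> g \<le> u \<and> 0 \<le> i \<and> i \<le> b \<and>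
             l * i \<le> s \<and> u * i + (g - u) * b \<le> s \<and>
             s \<le> u * i \<and> s \<le> (g - l) * b + l * i)}"
    unfolding S_def mer_feasible_iff[OF Q0] Let_def
    by (auto simp: mk_def split_beta intro: matrix_inv_eqI)

  have "closed S"
    unfolding S_eq Let_def
    by (intro closed_Collect_conj closed_Collect_all closed_Collect_eq closed_Collect_le
        closed_Collect_psd continuous_on_matrix_mult continuous_on_rtrace continuous_intros)

  have "bounded S"
  proof (rule bounded_subset)
    let ?A = "real CARD('n) * (real CARD('n) * budget I)"
    show "S \<subseteq> cball 0 ?A \<times> cball 0 C \<times>
        cbox (\<chi> k. fst (Q k)) (\<chi> k. snd (Q k)) \<times>
        cball 0 (real CARD('k) * ?A) \<times> cbox 0 (\<chi> k. snd (Q k) * int_bound I k)"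
    proof
      fix z assume z: "z \<in> S"
      obtain R X g W s where [simp]: "z = (R, X, g, W, s)"
        by (cases z)
      have V: "mer_feasible I Q (mk z)"
        using z by (simp add: S_def)
      then have cc: "common_constraints I (mk z)"
        by (simp add: mer_feasible_def)
      have "norm R \<le> ?A"
        using norm_psd_le[OF psd_covX[OF cc], of "budget I"] cc
        by (simp add: common_constraints_def mk_def)
      moreover have "norm W \<le> real CARD('k) * ?A"
      proof -
        have "norm (W $ k) \<le> ?A" for k
          using norm_psd_le[OF psd_beam[OF cc] rtrace_beam_le[OF cc], of k] by (simp add: mk_def)
        then have "(\<Sum>k\<in>UNIV. norm (W $ k)) \<le> (\<Sum>k\<in>(UNIV :: 'k set). ?A)"
          by (intro sum_mono)
        moreover have "norm W \<le> (\<Sum>k\<in>UNIV. norm (W $ k))"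
          by (simp add: norm_vec_def L2_set_le_sum)
        ultimately show ?thesis
          by simp
      qed
      moreover have "fst (Q k) \<le> g $ k \<and> g $ k \<le> snd (Q k) \<and> 0 \<le> s $ k \<and>
          s $ k \<le> snd (Q k) * int_bound I k" for k
      proof -
        let ?i = "interference I (mk z) k"
        have *: "fst (Q k) \<le> g $ k" "g $ k \<le> snd (Q k)" "0 \<le> ?i" "?i \<le> int_bound I k"
          "fst (Q k) * ?i \<le> s $ k" "s $ k \<le> snd (Q k) * ?i"
          using V by (simp_all add: mer_feasible_def Let_def mk_def)
        have "0 \<le> fst (Q k) * ?i"
          using Q0 * by simp
        moreover have "snd (Q k) * ?i \<le> snd (Q k) * int_bound I k"
          using Q0[of k] * by (intro mult_left_mono) auto
        ultimately show ?thesis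
          using * by linarith
      qed
      moreover have "norm X \<le> C"
        using z by (simp add: S_def)
      ultimately show "z \<in> cball 0 ?A \<times> cball 0 C \<times>
        cbox (\<chi> k. fst (Q k)) (\<chi> k. snd (Q k)) \<times>
        cball 0 (real CARD('k) * ?A) \<times> cbox 0 (\<chi> k. snd (Q k) * int_bound I k)"
        by (simp add: mem_box_cart)
    qed
  qed (intro bounded_Times bounded_cball bounded_cbox)
  then have "compact S"
    using \<open>closed S\<close> by (simp add: compact_eq_bounded_closed)

  have obj: "objective I (mk z) =
      - (\<Sum>k\<in>UNIV. ln (1 + fst (snd (snd z)) $ k)) + weight I * rtrace (fst (snd z))" if "z \<in> S" for z
    using that matrix_inv_eqI(2)[of "fst z" "fst (snd z)"]
    by (simp add: S_def objective_def mk_def split_beta)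
  \<comment> \<open>Needed for continuity of the logarithms, whose arguments are at least 1 on
    \<open>S\<close>.\<close>
  have pos: "1 + fst (snd (snd z)) $ k \<noteq> 0" if "z \<in> S" for z k
  proof -
    have "fst (Q k) \<le> fst (snd (snd z)) $ k"
      using that unfolding S_eq Let_def by blast
    then show ?thesis
      using Q0[of k] by linarith
  qed
  have "continuous_on S (\<lambda>z. - (\<Sum>k\<in>UNIV. ln (1 + fst (snd (snd z)) $ k)) + weight I * rtrace (fst (snd z)))"
    by (intro continuous_on_rtrace continuous_intros ballI pos)
  then have cont: "continuous_on S (\<lambda>z. objective I (mk z))"
    by (subst continuous_on_cong[OF refl obj])
  have "S \<noteq> {}"
    using enc_in_S[OF V0] by auto
  then obtain z where z: "z \<in> S" "\<And>y. y \<in> S \<Longrightarrow> objective I (mk z) \<le> objective I (mk y)"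
    using continuous_attains_inf[OF \<open>compact S\<close> _ cont] by blast
  \<comment> \<open>The minimum over \<open>S\<close> is global: points worse than \<open>V0\<close>
    are beaten by way of \<open>V0\<close>, whose encoding lies in \<open>S\<close>.\<close>
  have "objective I (mk z) \<le> objective I V" if V: "mer_feasible I Q V" for V
  proof (cases "objective I V \<le> objective I V0")
    case True
    then show ?thesis
      using z(2)[OF enc_in_S[OF V]] by (simp add: mk_enc)
  next
    case False
    then show ?thesis
      using z(2)[OF enc_in_S[OF V0]] by (simp add: mk_enc)
  qed
  then have "mer_optimal I Q (mk z)"
    using z(1) by (simp add: mer_optimal_def S_def)
  then show ?thesis ..
qed

section \<open>Branch and bound\<close>

lemma mer_value_eq: "mer_optimal I Q V \<Longrightarrow> mer_value I Q = ereal (objective I V)"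
  unfolding mer_value_def mer_optimal_def by (intro antisym INF_lower INF_greatest) auto

text \<open>\<open>mer_of\<close> lifts \<open>p\<close> to a relaxation point with the same
  objective value.\<close>

lemma objective_mer_optimal_le:
  assumes "mer_optimal I Q V" and "P_feasible I p" and "in_box Q p"
  shows "objective I V \<le> objective I p"
  using assms(1) mer_feasible_mer_of[OF assms(2,3)] objective_mer_of[of I p]
  unfolding mer_optimal_def by metis

text \<open>The maximum with \<open>1\<close> accounts for the factors of width less than \<open>\<delta>\<close>, which are never split.\<close>

definition box_size :: "real \<Rightarrow> 'k::finite box \<Rightarrow> real" where
  "box_size \<delta> Q = (\<Prod>k\<in>UNIV. max 1 ((snd (Q k) - fst (Q k)) / \<delta>))"

lemma box_size_ge_1: "1 \<le> box_size \<delta> Q"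
  unfolding box_size_def by (rule prod_ge_1) simp

text \<open>The split factor \<open>w\<close> is at least 2, so each half keeps a factor
  \<open>w / 2 \<ge> 1\<close>: the maximum with 1 is inactive and the sizes add up exactly.\<close>

lemma box_size_halves:
  assumes "\<delta> > 0" and "2 * \<delta> \<le> snd (Q k) - fst (Q k)"
  shows "box_size \<delta> (lower_half Q k) + box_size \<delta> (upper_half Q k) = box_size \<delta> Q"
proof -
  define r where "r = (\<Prod>j\<in>UNIV - {k}. max 1 ((snd (Q j) - fst (Q j)) / \<delta>))"
  define w where "w = (snd (Q k) - fst (Q k)) / \<delta>"
  have size: "box_size \<delta> Q' = max 1 ((snd (Q' k) - fst (Q' k)) / \<delta>) * r"
    if "\<And>j. j \<noteq> k \<Longrightarrow> Q' j = Q j" for Q'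
    unfolding box_size_def r_def by (subst prod.remove[of _ k]) (use that in auto)
  have "w \<ge> 2"
    using assms by (simp add: w_def pos_le_divide_eq)
  have half: "(midpt Q k - fst (Q k)) / \<delta> = w / 2" "(snd (Q k) - midpt Q k) / \<delta> = w / 2"
    by (simp_all add: w_def midpt_def field_simps)
  have "box_size \<delta> (lower_half Q k) = max 1 ((midpt Q k - fst (Q k)) / \<delta>) * r"
    by (subst size) (simp_all add: lower_half_def)
  moreover have "box_size \<delta> (upper_half Q k) = max 1 ((snd (Q k) - midpt Q k) / \<delta>) * r"
    by (subst size) (simp_all add: upper_half_def)
  moreover have "box_size \<delta> Q = max 1 w * r"
    by (simp add: size w_def)
  ultimately show ?thesis
    unfolding half using \<open>w \<ge> 2\<close> by simp
qed

lemma in_box_halves: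
  assumes "in_box Q p"
  shows "in_box (lower_half Q k) p \<or> in_box (upper_half Q k) p"
  using assms by (auto simp: in_box_def lower_half_def upper_half_def)

section \<open>Invariants of the search\<close>

text \<open>The last clause records that the upper bound \<open>U\<close> already accounts for the
  constructed point of an open node. It turns a failed stopping test into a lower bound on the loss
  incurred by that point.\<close>

definition node_ok :: "('n::finite, 'k::finite) inst \<Rightarrow> real \<Rightarrow> ('n, 'k) node \<Rightarrow> bool" where
  "node_ok I U = (\<lambda>(Q, V, L). (\<forall>k. 0 \<le> fst (Q k)) \<and> mer_optimal I Q V \<and>
     L = ereal (objective I V) \<and> U \<le> objective I (hat_point I Q V))"

definition state_ok :: "('n::finite, 'k::finite) inst \<Rightarrow> ('n, 'k) bnb_state \<Rightarrow> bool" where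
  "state_ok I s \<longleftrightarrow> P_feasible I (incumbent s) \<and> (\<forall>k. 0 \<le> sinr (incumbent s) k) \<and>
     objective I (incumbent s) = upper s \<and> (\<forall>nd\<in>#problems s. node_ok I (upper s) nd)"

text \<open>\<open>B\<close> holds the halves of the current split that are still to be processed.
  Boxes containing only points worse than \<open>upper s\<close> may be pruned, hence the
  comparison; it is non-strict so that the incumbent itself is covered.\<close>

definition covers ::
  "('n::finite, 'k::finite) inst \<Rightarrow> ('n, 'k) bnb_state \<Rightarrow> 'k box set \<Rightarrow> bool" where
  "covers I s B \<longleftrightarrow> (\<forall>p. P_feasible I p \<and> (\<forall>k. 0 \<le> sinr p k) \<and> objective I p \<le> upper s \<longrightarrow>
     (\<exists>Q\<in>fst ` set_mset (problems s) \<union> B. in_box Q p))"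

lemma covers_emptyE:
  assumes "covers I s {}" and "P_feasible I p" and "\<And>k. 0 \<le> sinr p k" and "objective I p \<le> upper s"
  obtains Q V L where "(Q, V, L) \<in># problems s" and "in_box Q p"
proof -
  have "\<exists>Q\<in>fst ` set_mset (problems s) \<union> {}. in_box Q p"
    using assms unfolding covers_def by blast
  then obtain Q where "Q \<in> fst ` set_mset (problems s)" and "in_box Q p"
    by blast
  then show ?thesis
    using that by force
qed

definition potential :: "real \<Rightarrow> ('n::finite, 'k::finite) bnb_state \<Rightarrow> real" where
  "potential \<delta> s = (\<Sum>nd\<in>#problems s. box_size \<delta> (fst nd) - 1)"

lemma potential_nonneg:
  fixes s :: "('n::finite, 'k::finite) bnb_state"
  shows "0 \<le> potential \<delta> s"
proof -
  have "0 \<le> (\<Sum>nd\<in>#M. box_size \<delta> (fst nd) - 1)" for M :: "('n, 'k) node multiset"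
    by (induction M) (simp_all add: box_size_ge_1)
  then show ?thesis
    by (simp add: potential_def)
qed

lemma node_ok_antimono: "node_ok I U nd \<Longrightarrow> U' \<le> U \<Longrightarrow> node_ok I U' nd"
  by (auto simp: node_ok_def)

text \<open>A box with infeasible relaxation contains no feasible point. Otherwise \<open>L\<close>
  is a lower bound for any feasible point in the box, so if one is no worse than the upper bound,
  the node passes the test and is kept.\<close>

lemma process_box_invariant:
  assumes "process_box I Q s s'" and "noise I > 0" and Q0: "\<And>k. 0 \<le> fst (Q k)"
    and ok: "state_ok I s" and cov: "covers I s (insert Q B)"
  shows "state_ok I s'" and "covers I s' B"
    and "potential \<delta> s' \<le> potential \<delta> s + (box_size \<delta> Q - 1)"
proof -
  have "state_ok I s' \<and> covers I s' B \<and> potential \<delta> s' \<le> potential \<delta> s + (box_size \<delta> Q - 1)"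
    using assms(1)
  proof cases
    case infeasible
    then have "\<not> in_box Q p" if "P_feasible I p" for p
      using mer_feasible_mer_of[OF that] by blast
    then have "covers I s B"
      using cov unfolding covers_def by blast
    then show ?thesis
      using infeasible ok box_size_ge_1[of \<delta> Q] by simp
  next
    case (feasible V L x)
    have V: "mer_feasible I Q V"
      using feasible(2) by (simp add: mer_optimal_def)
    have L: "L = ereal (objective I V)"
      using feasible mer_value_eq by blast
    have x: "P_feasible I x" "\<And>k. 0 \<le> sinr x k"
      using P_feasible_hat_point[OF V assms(2) Q0] hat_sinr_bounds(1)[OF V assms(2)] Q0
      unfolding feasible(4) by (auto simp: hat_point_def intro: order_trans)
    have up: "upper s' \<le> upper s"
      using feasible by simp
    have "node_ok I (upper s') (Q, V, L)"
      using feasible L Q0 by (simp add: node_ok_def)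
    moreover have "node_ok I (upper s') nd" if "nd \<in># problems s" for nd
      using that ok up by (auto simp: state_ok_def intro: node_ok_antimono)
    moreover have "set_mset (problems s') \<subseteq> insert (Q, V, L) (set_mset (problems s))"
      using feasible by auto
    ultimately have "\<forall>nd\<in>#problems s'. node_ok I (upper s') nd"
      by blast
    then have "state_ok I s'"
      using ok x feasible by (auto simp: state_ok_def)
    moreover have "covers I s' B"
      unfolding covers_def
    proof (intro allI impI)
      fix p assume p: "P_feasible I p \<and> (\<forall>k. 0 \<le> sinr p k) \<and> objective I p \<le> upper s'"
      then have "objective I p \<le> upper s"
        using up by simp
      then obtain Q' where Q': "Q' \<in> fst ` set_mset (problems s) \<union> insert Q B" "in_box Q' p"
        using cov p unfolding covers_def by meson
      have new: "Q \<in> fst ` set_mset (problems s')" if "Q' = Q"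
      proof -
        have "objective I V \<le> objective I p"
          using objective_mer_optimal_le[OF feasible(2)] p Q'(2) that by blast
        then show ?thesis
          using feasible(1) L \<open>objective I p \<le> upper s\<close> by simp
      qed
      have "set_mset (problems s) \<subseteq> set_mset (problems s')"
        using feasible by auto
      then have "fst ` set_mset (problems s) \<subseteq> fst ` set_mset (problems s')"
        by (rule image_mono)
      then have "Q' \<in> fst ` set_mset (problems s') \<union> B"
        using Q'(1) new by blast
      then show "\<exists>Q\<in>fst ` set_mset (problems s') \<union> B. in_box Q p"
        using Q'(2) by blast
    qed
    moreover have "potential \<delta> s' \<le> potential \<delta> s + (box_size \<delta> Q - 1)"
      using feasible box_size_ge_1[of \<delta> Q] by (simp add: potential_def)
    ultimately show ?thesis
      by blast
  qed
  then show "state_ok I s'" and "covers I s' B"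
    and "potential \<delta> s' \<le> potential \<delta> s + (box_size \<delta> Q - 1)"
    by blast+
qed

lemma process_box_exists:
  assumes "weight I > 0" and "\<And>k. 0 \<le> fst (Q k)"
  shows "\<exists>s'. process_box I Q s s'"
proof (cases "\<exists>V. mer_feasible I Q V")
  case True
  then obtain V where "mer_optimal I Q V"
    using mer_optimal_exists[OF assms(1), of Q] assms(2) by blast
  from process_box.feasible[OF this refl refl] show ?thesis
    by (rule exI)
next
  case False
  from process_box.infeasible[OF this] show ?thesis
    by (rule exI)
qed

text \<open>By the last clause of \<open>node_ok\<close>, a failed stopping test gives a loss of at
  least \<open>\<epsilon>\<close> at the constructed point; this forces a large maximal gap, and the
  width is at least the gap.\<close>

lemma branching_width:
  fixes I :: "('n::finite, 'k::finite) inst"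
  assumes "noise I > 0" and "state_ok I s" and "(Q, V, L) \<in># problems s"
    and "\<not> ereal (upper s) - L < ereal \<epsilon>" and "\<And>k. gap I Q V k \<le> gap I Q V k'"
  shows "exp (\<epsilon> / real CARD('k)) - 1 \<le> snd (Q k') - fst (Q k')"
proof -
  have ok: "node_ok I (upper s) (Q, V, L)"
    using assms(2,3) by (simp add: state_ok_def)
  then have Q0: "0 \<le> fst (Q k)" and V: "mer_feasible I Q V" for k
    by (simp_all add: node_ok_def mer_optimal_def)
  have "\<epsilon> \<le> objective I (hat_point I Q V) - objective I V"
    using ok assms(4) by (simp add: node_ok_def)
  then have "exp (\<epsilon> / real CARD('k)) - 1 \<le> gap I Q V k'"
    by (rule max_gap_ge[OF V assms(1) Q0 assms(5)])
  also have "\<dots> \<le> snd (Q k') - fst (Q k')"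
    by (rule gap_le_width[OF V assms(1) Q0])
  finally show ?thesis .
qed

text \<open>Removing the node lowers the potential by \<open>box_size \<delta> Q - 1\<close>, and
  its halves together add at most \<open>box_size \<delta> Q - 2\<close>.\<close>

lemma bnb_step_invariant:
  fixes I :: "('n::finite, 'k::finite) inst"
  assumes "bnb_step I \<epsilon> s s'" and "noise I > 0" and "\<delta> > 0"
    and \<delta>: "2 * \<delta> \<le> exp (\<epsilon> / real CARD('k)) - 1"
    and ok: "state_ok I s" and cov: "covers I s {}"
  shows "state_ok I s'" and "covers I s' {}" and "potential \<delta> s' + 1 \<le> potential \<delta> s"
proof -
  have "state_ok I s' \<and> covers I s' {} \<and> potential \<delta> s' + 1 \<le> potential \<delta> s"
    using assms(1)
  proof cases
    case (1 Q V L k' Q1 Q2 s1)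
    let ?s = "s\<lparr>problems := problems s - {#(Q, V, L)#}\<rparr>"
    have mem: "(Q, V, L) \<in># problems s"
      using 1(1) by (simp add: least_node_def)
    have width: "2 * \<delta> \<le> snd (Q k') - fst (Q k')"
      using branching_width[OF assms(2) ok mem 1(2)] 1(3) \<delta> by (smt (verit))
    have Q0: "0 \<le> fst (Q k)" for k
      using ok mem by (auto simp: state_ok_def node_ok_def)
    moreover have "0 \<le> midpt Q k'"
      using Q0[of k'] width \<open>\<delta> > 0\<close> by (simp add: midpt_def)
    ultimately have Q12: "0 \<le> fst (Q1 k)" "0 \<le> fst (Q2 k)" for k
      using 1(4) by (auto simp: lower_half_def upper_half_def)
    have size: "box_size \<delta> Q1 + box_size \<delta> Q2 = box_size \<delta> Q"
      using 1(4) box_size_halves[where Q = Q and k = k', OF \<open>\<delta> > 0\<close> width] by auto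
    have ok0: "state_ok I ?s"
      using ok by (auto simp: state_ok_def dest: in_diffD)
    have halves: "in_box Q1 p \<or> in_box Q2 p" if "in_box Q p" for p :: "('n, 'k) point"
      using 1(4) in_box_halves[OF that, of k'] by auto
    have cov0: "covers I ?s {Q1, Q2}"
      unfolding covers_def
    proof (intro allI impI)
      fix p assume p: "P_feasible I p \<and> (\<forall>k. 0 \<le> sinr p k) \<and> objective I p \<le> upper ?s"
      have "objective I p \<le> upper s"
        using p by simp
      then obtain Q' V' L' where Q': "(Q', V', L') \<in># problems s" "in_box Q' p"
        using covers_emptyE[OF cov] p by blast
      \<comment> \<open>Only the selected node is removed, so a covering node with another box
        survives; points covered through \<open>Q\<close> pass to one of the halves.\<close>
      have "(Q', V', L') \<in># problems ?s" if "Q' \<noteq> Q"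
        using Q'(1) that by (simp add: in_diff_count)
      then consider (split) "Q' = Q" | (old) "(Q', V', L') \<in># problems ?s"
        by blast
      then show "\<exists>Q\<in>fst ` set_mset (problems ?s) \<union> {Q1, Q2}. in_box Q p"
      proof cases
        case split
        then show ?thesis
          using halves Q'(2) by blast
      next
        case old
        then have "Q' \<in> fst ` set_mset (problems ?s)"
          by (rule image_eqI[rotated]) simp
        then show ?thesis
          using Q'(2) by blast
      qed
    qed
    note s1 = process_box_invariant[OF 1(5) assms(2) Q12(1) ok0 cov0]
    note s2 = process_box_invariant[OF 1(6) assms(2) Q12(2) s1(1,2)]
    have "potential \<delta> s = potential \<delta> ?s + (box_size \<delta> Q - 1)"
      using mem by (auto simp: potential_def dest!: multi_member_split)
    then show ?thesis
      using s2(1,2) s1(3)[of \<delta>] s2(3)[of \<delta>] size by simp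
  qed
  then show "state_ok I s'" and "covers I s' {}" and "potential \<delta> s' + 1 \<le> potential \<delta> s"
    by blast+
qed

section \<open>Initial state and runs\<close>

lemma covers_init_box:
  assumes "noise I > 0" and "P_feasible I p" and "\<And>k. 0 \<le> sinr p k"
  shows "in_box (init_box I) p"
  using P_feasible_sinr_le[OF assms(2,1)] assms(3) by (simp add: in_box_def init_box_def)

lemma bnb_init_exists:
  fixes I :: "('n::finite, 'k::finite) inst"
  assumes "noise I > 0" and "budget I > 0" and "weight I > 0"
  shows "\<exists>s. bnb_init I s"
proof -
  obtain p where p: "P_feasible I p" "\<And>k. sinr p k = 0"
    using P_feasible_exists[OF assms(2)] by blast
  then have "mer_feasible I (init_box I) (mer_of I p)"
    by (intro mer_feasible_mer_of covers_init_box assms) auto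
  then obtain V where "mer_optimal I (init_box I) V"
    using mer_optimal_exists[OF assms(3), of "init_box I"] by (auto simp: init_box_def)
  then show ?thesis
    unfolding bnb_init_def by blast
qed

lemma bnb_init_invariant:
  assumes "bnb_init I s" and "noise I > 0"
  shows "state_ok I s" and "covers I s {}" and "potential \<delta> s + 1 = box_size \<delta> (init_box I)"
proof -
  obtain V where V: "mer_optimal I (init_box I) V"
    and s: "s = \<lparr>problems = {#(init_box I, V, mer_value I (init_box I))#},
               upper = objective I (hat_point I (init_box I) V),
               incumbent = hat_point I (init_box I) V\<rparr>"
    using assms(1) by (auto simp: bnb_init_def)
  have Q0: "0 \<le> fst (init_box I k)" for k
    by (simp add: init_box_def)
  have feas: "mer_feasible I (init_box I) V"
    using V by (simp add: mer_optimal_def)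
  show "state_ok I s"
    using P_feasible_hat_point[OF feas assms(2) Q0] hat_sinr_bounds(1)[OF feas assms(2)] V
      mer_value_eq[OF V] order_trans[OF Q0]
    by (auto simp: state_ok_def s node_ok_def Q0) (auto simp: hat_point_def)
  show "covers I s {}"
    using covers_init_box[OF assms(2)] by (auto simp: covers_def s)
  show "potential \<delta> s + 1 = box_size \<delta> (init_box I)"
    by (simp add: potential_def s)
qed

text \<open>Each step trades a drop of the potential by at least 1 for one more state. The one-state
  run starts with equality, its only node being the initial box.\<close>

lemma bnb_run_invariant:
  fixes I :: "('n::finite, 'k::finite) inst"
  assumes "bnb_run I \<epsilon> ss" and "noise I > 0" and "\<delta> > 0"
    and "2 * \<delta> \<le> exp (\<epsilon> / real CARD('k)) - 1"
  shows "state_ok I (last ss) \<and> covers I (last ss) {} \<and>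
    potential \<delta> (last ss) + real (length ss) \<le> box_size \<delta> (init_box I)"
proof -
  have "ss \<noteq> []"
    using assms(1) by (simp add: bnb_run_def)
  then show ?thesis
    using assms(1)
  proof (induction ss rule: rev_nonempty_induct)
    case (single s)
    then have "bnb_init I s"
      by (simp add: bnb_run_def)
    then show ?case
      using bnb_init_invariant[OF _ assms(2), of s] bnb_init_invariant(3)[OF _ assms(2), of s \<delta>]
      by simp
  next
    case (snoc s ss)
    then have "bnb_run I \<epsilon> ss" and step: "bnb_step I \<epsilon> (last ss) s"
      by (auto simp: bnb_run_def successively_append_iff)
    then have IH: "state_ok I (last ss)" "covers I (last ss) {}"
      "potential \<delta> (last ss) + real (length ss) \<le> box_size \<delta> (init_box I)"
      using snoc.IH by auto
    show ?case
      using bnb_step_invariant[OF step assms(2-4) IH(1,2)] IH(3) by simp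
  qed
qed

section \<open>Progress, and correctness at termination\<close>

text \<open>The list is nonempty because the incumbent, being feasible with value
  \<open>upper s\<close>, lies in the box of an open node. A least node and a largest gap exist by
  finiteness, and both halves can be processed because feasible relaxations attain their
  optimum.\<close>

lemma bnb_step_exists:
  assumes "noise I > 0" and "weight I > 0" and "\<epsilon> > 0"
    and ok: "state_ok I s" and cov: "covers I s {}" and "\<not> bnb_stops \<epsilon> s"
  shows "\<exists>s'. bnb_step I \<epsilon> s s'"
proof -
  let ?A = "(\<lambda>nd. snd (snd nd)) ` set_mset (problems s)"
  have "P_feasible I (incumbent s)" "\<And>k. 0 \<le> sinr (incumbent s) k"
    "objective I (incumbent s) \<le> upper s"
    using ok by (simp_all add: state_ok_def)
  then obtain Q0 V0 L0 where "(Q0, V0, L0) \<in># problems s"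
    using covers_emptyE[OF cov] by metis
  then have "?A \<noteq> {}"
    by auto
  then have "Min ?A \<in> ?A"
    by (intro Min_in) auto
  then obtain nd where "nd \<in># problems s" "snd (snd nd) = Min ?A"
    by auto
  then have least: "least_node s nd"
    by (auto simp: least_node_def)
  obtain Q V L where nd: "nd = (Q, V, L)"
    by (cases nd)
  have mem: "(Q, V, L) \<in># problems s"
    using least by (simp add: nd least_node_def)
  have nonstop: "\<not> ereal (upper s) - L < ereal \<epsilon>"
    using assms(6) least nd by (auto simp: bnb_stops_def)
  have "Max (range (gap I Q V)) \<in> range (gap I Q V)"
    by (intro Max_in) auto
  then obtain k' where k': "gap I Q V k' = Max (range (gap I Q V))"
    by (metis rangeE)
  have max: "gap I Q V k \<le> gap I Q V k'" for k
    unfolding k' by (rule Max_ge) auto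
  \<comment> \<open>Positive width puts the midpoint above a nonnegative lower end, so both halves
    keep nonnegative lower ends.\<close>
  have "0 < snd (Q k') - fst (Q k')"
    using branching_width[OF assms(1) ok mem nonstop max] assms(3)
    by (smt (verit) divide_pos_pos exp_gt_one of_nat_0_less_iff zero_less_card_finite)
  moreover have Q0: "0 \<le> fst (Q k)" for k
    using ok mem by (auto simp: state_ok_def node_ok_def)
  ultimately have "0 \<le> fst (Q k') + snd (Q k')"
    using Q0[of k'] by linarith
  then have "0 \<le> midpt Q k'"
    by (simp add: midpt_def)
  then have Q12: "0 \<le> fst (lower_half Q k' k)" "0 \<le> fst (upper_half Q k' k)" for k
    using Q0 by (auto simp: lower_half_def upper_half_def)
  obtain s1 where s1:
    "process_box I (lower_half Q k') (s\<lparr>problems := problems s - {#(Q, V, L)#}\<rparr>) s1"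
    using process_box_exists[where Q = "lower_half Q k'", OF assms(2) Q12(1)] by blast
  obtain s2 where "process_box I (upper_half Q k') s1 s2"
    using process_box_exists[where Q = "upper_half Q k'", OF assms(2) Q12(2)] by blast
  then show ?thesis
    using bnb_step.intros[OF least[unfolded nd] nonstop _ _ s1] max by blast
qed

text \<open>The smallest bound \<open>L\<close> lies below the value of every covered point, among
  them the incumbent, and hence below the value of any point worse than the upper bound. Negative
  SINRs are first raised to zero.\<close>

lemma eps_optimal_incumbent:
  fixes I :: "('n::finite, 'k::finite) inst"
  assumes "noise I > 0" and ok: "state_ok I s" and cov: "covers I s {}" and "bnb_stops \<epsilon> s"
  shows "eps_optimal I \<epsilon> (incumbent s)"
proof -
  obtain Q V L where least: "least_node s (Q, V, L)" and stop: "ereal (upper s) - L < ereal \<epsilon>"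
    using assms(4) by (auto simp: bnb_stops_def)
  have L: "L = ereal (objective I V)"
    using ok least by (auto simp: state_ok_def node_ok_def least_node_def)
  have bound: "objective I V \<le> objective I p"
    if p: "P_feasible I p" "\<And>k. 0 \<le> sinr p k" "objective I p \<le> upper s" for p
  proof -
    obtain Q' V' L' where mem: "(Q', V', L') \<in># problems s" and box: "in_box Q' p"
      by (rule covers_emptyE[OF cov p])
    have "mer_optimal I Q' V'" "L' = ereal (objective I V')"
      using ok mem by (auto simp: state_ok_def node_ok_def)
    moreover have "L \<le> L'"
      using least mem by (auto simp: least_node_def)
    ultimately show ?thesis
      using objective_mer_optimal_le[OF _ p(1) box] L by fastforce
  qed
  have inc: "P_feasible I (incumbent s)" "objective I (incumbent s) = upper s"
    "\<And>k. 0 \<le> sinr (incumbent s) k"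
    using ok by (auto simp: state_ok_def)
  have "objective I V \<le> objective I p" if "P_feasible I p" for p
  proof -
    let ?p = "p\<lparr>sinr := \<lambda>k. max 0 (sinr p k)\<rparr>"
    have "objective I V \<le> upper s"
      using bound[of "incumbent s"] inc by simp
    then have "objective I V \<le> objective I ?p"
      using bound[of ?p] P_feasible_pos_part(1)[OF that] by (cases "objective I ?p \<le> upper s") auto
    then show ?thesis
      using P_feasible_pos_part(2)[OF that] by simp
  qed
  then have "L \<le> P_value I"
    unfolding P_value_def L by (intro INF_greatest) auto
  then have "ereal (upper s) - P_value I \<le> ereal (upper s) - L"
    by (intro ereal_minus_mono) auto
  also have "\<dots> \<le> ereal \<epsilon>"
    using stop by simp
  finally show ?thesis
    using inc by (simp add: eps_optimal_def)
qed

text \<open>Each factor is at most \<open>max 1 (\<Gamma>max / \<delta>)\<close>. The summand 1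
  covers the case where this maximum is 1.\<close>

lemma box_size_init_box_le:
  fixes I :: "('n::finite, 'k::finite) inst"
  assumes "noise I > 0" and "budget I > 0" and "\<delta> > 0"
    and "\<Gamma>max = (MAX k. budget I * (norm (channel I k))\<^sup>2 / noise I)"
  shows "box_size \<delta> (init_box I) \<le> (\<Gamma>max / \<delta>) ^ CARD('k) + 1"
proof -
  have \<Gamma>: "budget I * (norm (channel I k))\<^sup>2 / noise I \<le> \<Gamma>max" for k
    unfolding assms(4) by (rule Max_ge) auto
  have "0 \<le> budget I * (norm (channel I undefined))\<^sup>2 / noise I"
    using assms by simp
  then have "0 \<le> \<Gamma>max"
    using \<Gamma>[of undefined] by linarith
  have "box_size \<delta> (init_box I) \<le> (\<Prod>k\<in>(UNIV :: 'k set). max 1 (\<Gamma>max / \<delta>))"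
    unfolding box_size_def
  proof (rule prod_mono)
    fix k
    have "(snd (init_box I k) - fst (init_box I k)) / \<delta> \<le> \<Gamma>max / \<delta>"
      using \<Gamma>[of k] assms(3) by (intro divide_right_mono) (auto simp: init_box_def)
    then show "0 \<le> max 1 ((snd (init_box I k) - fst (init_box I k)) / \<delta>) \<and>
        max 1 ((snd (init_box I k) - fst (init_box I k)) / \<delta>) \<le> max 1 (\<Gamma>max / \<delta>)"
      by auto
  qed
  also have "\<dots> \<le> (\<Gamma>max / \<delta>) ^ CARD('k) + 1"
    using \<open>0 \<le> \<Gamma>max\<close> assms(3) by (auto simp: max_def)
  finally show ?thesis .
qed

theorem theorem2:
  fixes I :: "('n::finite, 'k::finite) inst" and \<epsilon> \<Gamma>max \<delta> :: real
  assumes "CARD('k) \<le> CARD('n)"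
    and "noise I > 0" and "budget I > 0" and "weight I > 0"
    and "\<epsilon> > 0"
    and "\<Gamma>max = (MAX k. budget I * (norm (channel I k))\<^sup>2 / noise I)"
    and "\<delta> = (exp (\<epsilon> / real CARD('k)) - 1) / 2"
  shows "(\<exists>s. bnb_init I s) \<and>
         (\<forall>ss. bnb_run I \<epsilon> ss \<longrightarrow>
            real (length ss) \<le> (\<Gamma>max / \<delta>) ^ CARD('k) + 1 \<and>
            (if bnb_stops \<epsilon> (last ss)
             then eps_optimal I \<epsilon> (incumbent (last ss))
             else (\<exists>s'. bnb_step I \<epsilon> (last ss) s')))"
proof (intro conjI allI impI)
  show "\<exists>s. bnb_init I s"
    by (rule bnb_init_exists[OF assms(2-4)])
next
  fix ss assume run: "bnb_run I \<epsilon> ss"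
  have "exp (\<epsilon> / real CARD('k)) > 1"
    using assms(5) by simp
  then have "\<delta> > 0"
    by (simp add: assms(7))
  moreover have two_\<delta>: "2 * \<delta> \<le> exp (\<epsilon> / real CARD('k)) - 1"
    by (simp add: assms(7))
  ultimately have inv: "state_ok I (last ss)" "covers I (last ss) {}"
    "potential \<delta> (last ss) + real (length ss) \<le> box_size \<delta> (init_box I)"
    using bnb_run_invariant[OF run assms(2) _ two_\<delta>] by blast+
  show "real (length ss) \<le> (\<Gamma>max / \<delta>) ^ CARD('k) + 1"
    using inv(3) potential_nonneg[of \<delta> "last ss"]
      box_size_init_box_le[OF assms(2,3) \<open>\<delta> > 0\<close> assms(6)] by linarith
  \<comment> \<open>A run that has not stopped can be continued, and the length bound forbids
    continuing forever, so every maximal run ends in a stopping state.\<close>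
  show "if bnb_stops \<epsilon> (last ss) then eps_optimal I \<epsilon> (incumbent (last ss))
        else (\<exists>s'. bnb_step I \<epsilon> (last ss) s')"
    using eps_optimal_incumbent[OF assms(2) inv(1,2)] bnb_step_exists[OF assms(2,4,5) inv(1,2)]
    by simp
qed

end
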